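(* Let $(M,\omega)$ be a multisymplectic manifold of degree $k+1$. For $i=1,2$ let $\alpha_i\in\Omega^{k-q_i}_H(T^*M)$ be a Hamiltonian form with associated Hamiltonian multivector field $Q_i\in\Omega^{q_i}_H(TM)$ (so $Q_i\lrcorner\omega=d\alpha_i$), where $q_1+q_2=k+1$. Then $\{\alpha_1,\alpha_2\}=0$ if and only if $\mathcal{L}_{Q_2}\alpha_1=0$, and also if and only if $\mathcal{L}_{Q_1}\alpha_2=0$.
   Context: A multisymplectic manifold of degree (order) $k+1$ is a smooth manifold $M$ with a closed $(k+1)$-form $\omega$ that is nondegenerate in the sense that, for a vector field $X$, $X\lrcorner\omega=0$ if and only if $X=0$. $\Omega^q(TM)$ denotes smooth $q$-multivector fields (sections of $\Lambda^qTM$) and $\Omega^l(T^*M)$ smooth differential $l$-forms. Contraction is $(X_1\wedge\cdots\wedge X_q)\lrcorner\phi=X_q\lrcorner\cdots\lrcorner X_1\lrcorner\phi$, extended linearly, and $Q\lrcorner\phi=0$ when the degree of $Q$ exceeds that of $\phi$. For $1\le q\le k$, a $q$-multivector field $Q$ is Hamiltonian ($Q\in\Omega^q_H(TM)$) if $Q\lrcorner\omega=d\alpha$ for some $(k-q)$-form $\alpha$; a $(k-q)$-form $\alpha$ is Hamiltonian ($\alpha\in\Omega^{k-q}_H(T^*M)$) if there is a $q$-multivector field $Q$ with $Q\lrcorner\omega=d\alpha$, and such a $Q$ is called an associated Hamiltonian multivector field. For Hamiltonian forms $\alpha_i\in\Omega^{k-q_i}_H(T^*M)$ with associated $Q_i$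 the bracket is $$\{\alpha_1,\alpha_2\}=(-1)^{q_1+q_2+1}(Q_1\wedge Q_2)\lrcorner\omega,$$ with $\{\alpha_1,\alpha_2\}=0$ if $q_1+q_2>k+1$; it is independent of the choice of $Q_1,Q_2$. For $Q\in\Omega^q(TM)$ and a form $\alpha$, the Lie derivative along $Q$ is $\mathcal{L}_Q\alpha=Q\lrcorner d\alpha-(-1)^q d(Q\lrcorner\alpha)$. *)

theory Defs
  imports "HOL-Analysis.Analysis"
begin

section \<open>Smooth manifolds\<close>

primrec Ck_on :: "nat \<Rightarrow> 'e::real_normed_vector set \<Rightarrow> ('e \<Rightarrow> 'f::real_normed_vector) \<Rightarrow> bool" where
  "Ck_on 0 S f \<longleftrightarrow> continuous_on S f"
| "Ck_on (Suc n) S f \<longleftrightarrow> (\<forall>x\<in>S. f differentiable (at x)) \<and>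
     (\<forall>v. Ck_on n S (\<lambda>x. frechet_derivative f (at x) v))"

text \<open>Only used for open sets of a finite-dimensional space.\<close>
definition smooth_on :: "'e::real_normed_vector set \<Rightarrow> ('e \<Rightarrow> 'f::real_normed_vector) \<Rightarrow> bool" where
  "smooth_on S f \<longleftrightarrow> (\<forall>n. Ck_on n S f)"

text \<open>A chart is a domain together with a coordinate map, which is irrelevant outside the domain.\<close>
type_synonym ('m, 'e) chart = "'m set \<times> ('m \<Rightarrow> 'e)"

text \<open>
  The manifold is the whole type \<open>'m\<close>; its smooth structure is the one generated by the atlas.
  The model space is an arbitrary finite-dimensional normed space rather than a
  \<open>euclidean_space\<close>, because that class excludes dimension 0.
\<close>
definition smooth_manifold ::
    "('m::{t2_space,second_countable_topology}, 'e::real_normed_vector) chart set \<Rightarrow> bool" where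
  "smooth_manifold A \<longleftrightarrow>
     (\<exists>B::'e set. finite B \<and> span B = UNIV) \<and>
     (\<Union>(U, \<phi>)\<in>A. U) = UNIV \<and>
     (\<forall>(U, \<phi>)\<in>A. open U \<and> open (\<phi> ` U) \<and> homeomorphism U (\<phi> ` U) \<phi> (inv_into U \<phi>)) \<and>
     (\<forall>(U, \<phi>)\<in>A. \<forall>(V, \<psi>)\<in>A. smooth_on (\<phi> ` (U \<inter> V)) (\<psi> \<circ> inv_into U \<phi>))"

definition smooth_fun :: "('m, 'e::real_normed_vector) chart set \<Rightarrow> ('m \<Rightarrow> real) \<Rightarrow> bool" where
  "smooth_fun A f \<longleftrightarrow> (\<forall>(U, \<phi>)\<in>A. smooth_on (\<phi> ` U) (f \<circ> inv_into U \<phi>))"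


section \<open>Tangent vectors and vector fields\<close>

text \<open>
  Tangent vectors at \<open>p\<close> are the derivations at \<open>p\<close> of the algebra of smooth functions. They are
  set to 0 on all other functions, so that equality of tangent vectors is equality in HOL.
\<close>
type_synonym 'm tangent = "('m \<Rightarrow> real) \<Rightarrow> real"

definition tangent_space :: "('m, 'e::real_normed_vector) chart set \<Rightarrow> 'm \<Rightarrow> 'm tangent set" where
  "tangent_space A p = {X.
     (\<forall>f g a b. smooth_fun A f \<longrightarrow> smooth_fun A g \<longrightarrow>
        X (\<lambda>x. a * f x + b * g x) = a * X f + b * X g) \<and>
     (\<forall>f g. smooth_fun A f \<longrightarrow> smooth_fun A g \<longrightarrow>
        X (\<lambda>x. f x * g x) = X f * g p + f p * X g) \<and>
     (\<forall>f. \<not> smooth_fun A f \<longrightarrow> X f = 0)}"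

text \<open>The coordinate vector at \<open>p\<close> with components \<open>v\<close> in the chart \<open>(U, \<phi>)\<close>.\<close>
definition coord_vec ::
    "('m, 'e::real_normed_vector) chart set \<Rightarrow> ('m, 'e) chart \<Rightarrow> 'm \<Rightarrow> 'e \<Rightarrow> 'm tangent" where
  "coord_vec A c p v = (\<lambda>f. if smooth_fun A f
     then frechet_derivative (f \<circ> inv_into (fst c) (snd c)) (at (snd c p)) v else 0)"

definition vector_field :: "('m, 'e::real_normed_vector) chart set \<Rightarrow> ('m \<Rightarrow> 'm tangent) \<Rightarrow> bool" where
  "vector_field A X \<longleftrightarrow> (\<forall>(U, \<phi>)\<in>A. \<exists>V. smooth_on (\<phi> ` U) V \<and>
     (\<forall>p\<in>U. X p = coord_vec A (U, \<phi>) p (V (\<phi> p))))"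


section \<open>Differential forms\<close>

text \<open>
  Alternating \<open>l\<close>-linear forms on the tangent space at \<open>p\<close>, extended by 0 to all lists that are not
  \<open>l\<close>-tuples of tangent vectors at \<open>p\<close>.
\<close>
definition alt_forms ::
    "('m, 'e::real_normed_vector) chart set \<Rightarrow> 'm \<Rightarrow> nat \<Rightarrow> ('m tangent list \<Rightarrow> real) set" where
  "alt_forms A p l = {\<eta>.
     (\<forall>Xs. \<eta> Xs \<noteq> 0 \<longrightarrow> length Xs = l \<and> set Xs \<subseteq> tangent_space A p) \<and>
     (\<forall>Xs i X Y a b. length Xs = l \<longrightarrow> set Xs \<subseteq> tangent_space A p \<longrightarrow> i < l \<longrightarrow>
        X \<in> tangent_space A p \<longrightarrow> Y \<in> tangent_space A p \<longrightarrow>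
        \<eta> (Xs[i := (\<lambda>f. a * X f + b * Y f)]) = a * \<eta> (Xs[i := X]) + b * \<eta> (Xs[i := Y])) \<and>
     (\<forall>Xs i j. i < j \<longrightarrow> j < length Xs \<longrightarrow> Xs ! i = Xs ! j \<longrightarrow> \<eta> Xs = 0)}"

type_synonym 'm form = "'m \<Rightarrow> 'm tangent list \<Rightarrow> real"

definition zero_form :: "'m form" where
  "zero_form = (\<lambda>p Xs. 0)"

definition smooth_form ::
    "('m, 'e::real_normed_vector) chart set \<Rightarrow> nat \<Rightarrow> 'm form \<Rightarrow> bool" where
  "smooth_form A l \<alpha> \<longleftrightarrow> (\<forall>p. \<alpha> p \<in> alt_forms A p l) \<and>
     (\<forall>(U, \<phi>)\<in>A. \<forall>vs. length vs = l \<longrightarrow>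
        smooth_on (\<phi> ` U) (\<lambda>x. \<alpha> (inv_into U \<phi> x) (map (coord_vec A (U, \<phi>) (inv_into U \<phi> x)) vs)))"

text \<open>
  The exterior derivative, computed in a chart around \<open>p\<close>: if \<open>X\<^sub>i\<close> has components \<open>v\<^sub>i\<close>, then
  \<open>(d\<alpha>)\<^sub>p(X\<^sub>0, \<dots>, X\<^sub>l)\<close> is the sum over \<open>i\<close> of \<open>(-1)\<^sup>i\<close> times the derivative in direction \<open>v\<^sub>i\<close> of
  \<open>\<alpha>(\<dots>, \<partial>\<^sub>v\<^sub>j, \<dots>)\<^sub>j\<^sub>\<noteq>\<^sub>i\<close>. For a smooth form this does not depend on the chart. The degree is not an
  argument: for an \<open>l\<close>-form every summand vanishes unless \<open>Xs\<close> has length \<open>l + 1\<close>.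
\<close>
definition ext_deriv ::
    "('m, 'e::real_normed_vector) chart set \<Rightarrow> 'm form \<Rightarrow> 'm form" where
  "ext_deriv A \<alpha> p Xs = (if set Xs \<subseteq> tangent_space A p then
     (let c = (SOME c. c \<in> A \<and> p \<in> fst c);
          \<phi> = snd c;
          \<phi>' = inv_into (fst c) \<phi>;
          vs = map (inv (coord_vec A c p)) Xs
      in \<Sum>i<length vs. (-1) ^ i *
           frechet_derivative
             (\<lambda>x. \<alpha> (\<phi>' x) (map (coord_vec A c (\<phi>' x)) (take i vs @ drop (Suc i) vs)))
             (at (\<phi> p)) (vs ! i))
     else 0)"

definition interior_prod :: "('m \<Rightarrow> 'm tangent) \<Rightarrow> 'm form \<Rightarrow> 'm form" where
  "interior_prod X \<alpha> = (\<lambda>p Ys. \<alpha> p (X p # Ys))"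


section \<open>Multivector fields\<close>

text \<open>
  The exterior power \<open>\<Lambda>\<^sup>q T\<^sub>pM\<close> is realised inside the dual of the space of alternating \<open>q\<close>-forms: the
  decomposable \<open>X\<^sub>1 \<and> \<dots> \<and> X\<^sub>q\<close> is evaluation at \<open>(X\<^sub>1, \<dots>, X\<^sub>q)\<close>, and a \<open>q\<close>-vector is a finite linear
  combination of decomposables. As functions these functionals are extended by 0, so that
  equality of multivectors is again equality in HOL.
\<close>
type_synonym 'm multivector = "('m tangent list \<Rightarrow> real) \<Rightarrow> real"

definition decomposable ::
    "('m, 'e::real_normed_vector) chart set \<Rightarrow> 'm \<Rightarrow> 'm tangent list \<Rightarrow> 'm multivector" where
  "decomposable A p Xs = (\<lambda>\<eta>. if \<eta> \<in> alt_forms A p (length Xs) then \<eta> Xs else 0)"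

text \<open>In every chart, \<open>Q\<close> is a finite sum of wedge products of constant coordinate vectors, with
  smooth coefficients.\<close>
definition multivector_field ::
    "('m, 'e::real_normed_vector) chart set \<Rightarrow> nat \<Rightarrow> ('m \<Rightarrow> 'm multivector) \<Rightarrow> bool" where
  "multivector_field A q Q \<longleftrightarrow> (\<forall>(U, \<phi>)\<in>A. \<exists>(N::nat) c vs.
     (\<forall>j<N. smooth_on (\<phi> ` U) (c j) \<and> length (vs j) = q) \<and>
     (\<forall>p\<in>U. Q p = (\<lambda>\<eta>. \<Sum>j<N. c j (\<phi> p) *
        decomposable A p (map (coord_vec A (U, \<phi>) p) (vs j)) \<eta>)))"

text \<open>
  Wedge product and contraction are linear in each multivector argument and are determined by
  their values on decomposables; these are computed in \<open>wedge_decomposable\<close> and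
  \<open>contract_decomposable\<close>, the latter being the iterated interior product by \<open>X\<^sub>1\<close>, then
  \<open>X\<^sub>2\<close>, and so on. The contraction is 0 if the degree of the multivector exceeds that of the
  form, since forms vanish on lists of the wrong length.
\<close>
definition wedge ::
    "('m, 'e::real_normed_vector) chart set \<Rightarrow> ('m \<Rightarrow> 'm multivector) \<Rightarrow> ('m \<Rightarrow> 'm multivector)
      \<Rightarrow> 'm \<Rightarrow> 'm multivector" where
  "wedge A Q R = (\<lambda>p \<eta>. if \<exists>l. \<eta> \<in> alt_forms A p l
     then Q p (\<lambda>Xs. R p (\<lambda>Ys. \<eta> (Xs @ Ys))) else 0)"

definition contract :: "('m \<Rightarrow> 'm multivector) \<Rightarrow> 'm form \<Rightarrow> 'm form" where
  "contract Q \<alpha> = (\<lambda>p Ys. Q p (\<lambda>Xs. \<alpha> p (Xs @ Ys)))"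

lemma alt_forms_zero: "(\<lambda>Xs. 0) \<in> alt_forms A p l"
  by (simp add: alt_forms_def)

lemma alt_formsI:
  assumes "\<And>Xs. \<eta> Xs \<noteq> 0 \<Longrightarrow> length Xs = l \<and> set Xs \<subseteq> tangent_space A p"
    and "\<And>Xs i X Y a b. \<lbrakk>length Xs = l; set Xs \<subseteq> tangent_space A p; i < l;
        X \<in> tangent_space A p; Y \<in> tangent_space A p\<rbrakk> \<Longrightarrow>
        \<eta> (Xs[i := (\<lambda>f. a * X f + b * Y f)]) = a * \<eta> (Xs[i := X]) + b * \<eta> (Xs[i := Y])"
    and "\<And>Xs i j. \<lbrakk>i < j; j < length Xs; Xs ! i = Xs ! j\<rbrakk> \<Longrightarrow> \<eta> Xs = 0"
  shows "\<eta> \<in> alt_forms A p l"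
  unfolding alt_forms_def mem_Collect_eq
  by (intro conjI allI impI) (fact assms(1)[THEN conjunct1] assms(1)[THEN conjunct2] assms(2) assms(3))+

lemma alt_forms_eq_0:
  assumes "\<eta> \<in> alt_forms A p l" "length Xs \<noteq> l \<or> \<not> set Xs \<subseteq> tangent_space A p"
  shows "\<eta> Xs = 0"
proof -
  have "\<eta> Xs \<noteq> 0 \<longrightarrow> length Xs = l \<and> set Xs \<subseteq> tangent_space A p"
    using assms(1) unfolding alt_forms_def mem_Collect_eq by (elim conjE allE)
  then show ?thesis using assms(2) by argo
qed

lemma alt_forms_lin:
  assumes "\<eta> \<in> alt_forms A p l" "length Xs = l" "set Xs \<subseteq> tangent_space A p" "i < l"
    "X \<in> tangent_space A p" "Y \<in> tangent_space A p"
  shows "\<eta> (Xs[i := (\<lambda>f. a * X f + b * Y f)]) = a * \<eta> (Xs[i := X]) + b * \<eta> (Xs[i := Y])"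
  using assms(1)[unfolded alt_forms_def mem_Collect_eq, THEN conjunct2, THEN conjunct1, rule_format,
      OF assms(2-6)] .

lemma alt_forms_alt:
  assumes "\<eta> \<in> alt_forms A p l" "i < j" "j < length Xs" "Xs ! i = Xs ! j"
  shows "\<eta> Xs = 0"
  using assms(1)[unfolded alt_forms_def mem_Collect_eq, THEN conjunct2, THEN conjunct2, rule_format,
      OF assms(2-4)] .

lemma alt_forms_append_right:
  assumes "\<eta> \<in> alt_forms A p (q + length Ys)"
  shows "(\<lambda>Xs. \<eta> (Xs @ Ys)) \<in> alt_forms A p q"
proof (cases "set Ys \<subseteq> tangent_space A p")
  case True
  have lin: "\<eta> (Xs[i := (\<lambda>f. a * X f + b * Y f)] @ Ys) = a * \<eta> (Xs[i := X] @ Ys) + b * \<eta> (Xs[i := Y] @ Ys)"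
    if "length Xs = q" "set Xs \<subseteq> tangent_space A p" "i < q" "X \<in> tangent_space A p" "Y \<in> tangent_space A p"
    for Xs i X Y a b
  proof -
    have "length (Xs @ Ys) = q + length Ys" "set (Xs @ Ys) \<subseteq> tangent_space A p" "i < q + length Ys"
      using that True by auto
    from alt_forms_lin[OF assms this that(4,5)] have "\<eta> ((Xs @ Ys)[i := (\<lambda>f. a * X f + b * Y f)]) =
        a * \<eta> ((Xs @ Ys)[i := X]) + b * \<eta> ((Xs @ Ys)[i := Y])"
      .
    then show ?thesis using that by (simp add: list_update_append1)
  qed
  have alt: "\<eta> (Xs @ Ys) = 0" if "i < j" "j < length Xs" "Xs ! i = Xs ! j" for Xs i j
  proof -
    have "(Xs @ Ys) ! i = (Xs @ Ys) ! j" "j < length (Xs @ Ys)"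
      using that by (simp_all add: nth_append)
    then show ?thesis using alt_forms_alt[OF assms that(1)] by blast
  qed
  have supp: "length Xs = q \<and> set Xs \<subseteq> tangent_space A p" if "\<eta> (Xs @ Ys) \<noteq> 0" for Xs
    using alt_forms_eq_0[OF assms, of "Xs @ Ys"] that by auto
  show ?thesis
    using supp lin alt by (rule alt_formsI)
next
  case False
  then have "(\<lambda>Xs. \<eta> (Xs @ Ys)) = (\<lambda>Xs. 0)"
    using alt_forms_eq_0[OF assms] by auto
  then show ?thesis by (simp add: alt_forms_zero)
qed

lemma alt_forms_append_left:
  assumes "\<eta> \<in> alt_forms A p (length Xs + r)"
  shows "(\<lambda>Ys. \<eta> (Xs @ Ys)) \<in> alt_forms A p r"
proof (cases "set Xs \<subseteq> tangent_space A p")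
  case True
  have lin: "\<eta> (Xs @ Ys[i := (\<lambda>f. a * X f + b * Y f)]) = a * \<eta> (Xs @ Ys[i := X]) + b * \<eta> (Xs @ Ys[i := Y])"
    if "length Ys = r" "set Ys \<subseteq> tangent_space A p" "i < r" "X \<in> tangent_space A p" "Y \<in> tangent_space A p"
    for Ys i X Y a b
  proof -
    have "length (Xs @ Ys) = length Xs + r" "set (Xs @ Ys) \<subseteq> tangent_space A p" "length Xs + i < length Xs + r"
      using that True by auto
    from alt_forms_lin[OF assms this that(4,5)] have "\<eta> ((Xs @ Ys)[length Xs + i := (\<lambda>f. a * X f + b * Y f)]) =
        a * \<eta> ((Xs @ Ys)[length Xs + i := X]) + b * \<eta> ((Xs @ Ys)[length Xs + i := Y])"
      .
    then show ?thesis by (simp add: list_update_append)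
  qed
  have alt: "\<eta> (Xs @ Ys) = 0" if "i < j" "j < length Ys" "Ys ! i = Ys ! j" for Ys i j
  proof -
    have "(Xs @ Ys) ! (length Xs + i) = (Xs @ Ys) ! (length Xs + j)"
      "length Xs + j < length (Xs @ Ys)" "length Xs + i < length Xs + j"
      using that by simp_all
    then show ?thesis using alt_forms_alt[OF assms] by blast
  qed
  have supp: "length Ys = r \<and> set Ys \<subseteq> tangent_space A p" if "\<eta> (Xs @ Ys) \<noteq> 0" for Ys
    using alt_forms_eq_0[OF assms, of "Xs @ Ys"] that by auto
  show ?thesis
    using supp lin alt by (rule alt_formsI)
next
  case False
  then have "(\<lambda>Ys. \<eta> (Xs @ Ys)) = (\<lambda>Ys. 0)"
    using alt_forms_eq_0[OF assms] by auto
  then show ?thesis by (simp add: alt_forms_zero)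
qed

lemma decomposable_append_right:
  assumes "\<eta> \<in> alt_forms A p l"
  shows "decomposable A p Xs (\<lambda>Zs. \<eta> (Zs @ Ys)) = \<eta> (Xs @ Ys)"
proof (cases "length Xs + length Ys = l")
  case True
  then show ?thesis
    using alt_forms_append_right[of \<eta> A p "length Xs" Ys] assms unfolding decomposable_def by simp
next
  case False
  then have "\<eta> (Xs @ Ys) = 0" using alt_forms_eq_0[OF assms, of "Xs @ Ys"] by simp
  then show ?thesis by (simp add: decomposable_def)
qed

lemma decomposable_append_left:
  assumes "\<eta> \<in> alt_forms A p l"
  shows "decomposable A p Ys (\<lambda>Zs. \<eta> (Xs @ Zs)) = \<eta> (Xs @ Ys)"
proof (cases "length Xs + length Ys = l")
  case True
  then show ?thesis
    using alt_forms_append_left[of \<eta> A p Xs "length Ys"] assms unfolding decomposable_def by simp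
next
  case False
  then have "\<eta> (Xs @ Ys) = 0" using alt_forms_eq_0[OF assms, of "Xs @ Ys"] by simp
  then show ?thesis by (simp add: decomposable_def)
qed

lemma contract_decomposable:
  assumes "\<alpha> p \<in> alt_forms A p l" "Q p = decomposable A p (map (\<lambda>X. X p) Xs)"
  shows "contract Q \<alpha> p = fold interior_prod Xs \<alpha> p"
proof -
  have "fold interior_prod Xs \<beta> p Ys = \<beta> p (map (\<lambda>X. X p) Xs @ Ys)" for \<beta> Ys
    by (induction Xs arbitrary: \<beta>) (simp_all add: interior_prod_def)
  then show ?thesis
    using decomposable_append_right[OF assms(1)] assms(2) by (simp add: contract_def fun_eq_iff)
qed

lemma wedge_decomposable:
  assumes "Q p = decomposable A p Xs" "R p = decomposable A p Ys"
  shows "wedge A Q R p = decomposable A p (Xs @ Ys)"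
proof (rule ext)
  fix \<eta>
  show "wedge A Q R p \<eta> = decomposable A p (Xs @ Ys) \<eta>"
  proof (cases "\<exists>l. \<eta> \<in> alt_forms A p l")
    case True
    then obtain l where l: "\<eta> \<in> alt_forms A p l" by blast
    have "wedge A Q R p \<eta> = \<eta> (Xs @ Ys)"
      using True assms by (simp add: wedge_def decomposable_append_left[OF l]
          decomposable_append_right[OF l])
    moreover have "\<eta> (Xs @ Ys) = 0" if "\<eta> \<notin> alt_forms A p (length (Xs @ Ys))"
      using that l alt_forms_eq_0[OF l, of "Xs @ Ys"] by metis
    ultimately show ?thesis by (auto simp: decomposable_def)
  next
    case False
    then show ?thesis by (simp add: wedge_def decomposable_def)
  qed
qed


section \<open>Multisymplectic manifolds, Hamiltonian forms and their bracket\<close>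

definition multisymplectic ::
    "('m::{t2_space,second_countable_topology}, 'e::real_normed_vector) chart set \<Rightarrow> nat \<Rightarrow> 'm form
      \<Rightarrow> bool" where
  "multisymplectic A k \<omega> \<longleftrightarrow> smooth_manifold A \<and> smooth_form A (k + 1) \<omega> \<and>
     ext_deriv A \<omega> = zero_form \<and>
     (\<forall>X. vector_field A X \<longrightarrow> (interior_prod X \<omega> = zero_form \<longleftrightarrow> (\<forall>p. X p = (\<lambda>f. 0))))"

definition associated ::
    "('m, 'e::real_normed_vector) chart set \<Rightarrow> 'm form \<Rightarrow> nat \<Rightarrow> 'm form \<Rightarrow> ('m \<Rightarrow> 'm multivector)
      \<Rightarrow> bool" where
  "associated A \<omega> q \<alpha> Q \<longleftrightarrow> multivector_field A q Q \<and> contract Q \<omega> = ext_deriv A \<alpha>"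

definition hamiltonian_form ::
    "('m, 'e::real_normed_vector) chart set \<Rightarrow> nat \<Rightarrow> 'm form \<Rightarrow> nat \<Rightarrow> 'm form \<Rightarrow> bool" where
  "hamiltonian_form A k \<omega> q \<alpha> \<longleftrightarrow> 1 \<le> q \<and> q \<le> k \<and> smooth_form A (k - q) \<alpha> \<and>
     (\<exists>Q. associated A \<omega> q \<alpha> Q)"

text \<open>The bracket of a \<open>(k - q1)\<close>-form and a \<open>(k - q2)\<close>-form, computed with arbitrarily chosen
  associated multivector fields. The degrees are arguments because they cannot be read off from
  the zero form.\<close>
definition bracket ::
    "('m, 'e::real_normed_vector) chart set \<Rightarrow> nat \<Rightarrow> 'm form \<Rightarrow> nat \<Rightarrow> nat \<Rightarrow> 'm form \<Rightarrow> 'm form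
      \<Rightarrow> 'm form" where
  "bracket A k \<omega> q1 q2 \<alpha>1 \<alpha>2 = (if q1 + q2 > k + 1 then zero_form
     else (let Q1 = (SOME Q. associated A \<omega> q1 \<alpha>1 Q); Q2 = (SOME Q. associated A \<omega> q2 \<alpha>2 Q)
           in (\<lambda>p Ys. (-1) ^ (q1 + q2 + 1) * contract (wedge A Q1 Q2) \<omega> p Ys)))"

definition lie_deriv ::
    "('m, 'e::real_normed_vector) chart set \<Rightarrow> nat \<Rightarrow> ('m \<Rightarrow> 'm multivector) \<Rightarrow> 'm form \<Rightarrow> 'm form" where
  "lie_deriv A q Q \<alpha> = (\<lambda>p Ys. contract Q (ext_deriv A \<alpha>) p Ys
     - (-1) ^ q * ext_deriv A (contract Q \<alpha>) p Ys)"

end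

theory Submission
  imports Defs
begin

text \<open>
  The form \<open>\<alpha>1\<close> has degree \<open>k - q1 = q2 - 1\<close>, so its contraction with \<open>Q2\<close> vanishes for degree
  reasons and its Lie derivative along \<open>Q2\<close> reduces to the contraction with \<open>Q2\<close> of \<open>d\<alpha>1\<close>, which is
  the contraction of \<open>\<omega>\<close> with \<open>Q1\<close>; so it is the contraction of \<open>\<omega>\<close> with \<open>Q1 \<and> Q2\<close>. This is the
  bracket up to sign. Contractions commute up to sign, so the bracket does not depend on the chosen
  associated fields, and exchanging \<open>Q1\<close> and \<open>Q2\<close> gives the second equivalence.
\<close>

section \<open>Alternating forms: sign rules, sums, partial evaluation\<close>

lemma tangent_space_add:
  assumes "X \<in> tangent_space A p" "Y \<in> tangent_space A p"
  shows "(\<lambda>f. X f + Y f) \<in> tangent_space A p"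
  using assms unfolding tangent_space_def by (simp add: algebra_simps)

lemma alt_forms_add_entry:
  assumes "\<eta> \<in> alt_forms A p l"
    and "set (Us @ Vs) \<subseteq> tangent_space A p" "X \<in> tangent_space A p" "Y \<in> tangent_space A p"
  shows "\<eta> (Us @ (\<lambda>f. X f + Y f) # Vs) = \<eta> (Us @ X # Vs) + \<eta> (Us @ Y # Vs)"
proof (cases "length (Us @ X # Vs) = l")
  case True
  then show ?thesis
    using alt_forms_lin[OF assms(1) True, of "length Us" X Y 1 1] assms
    by (simp add: list_update_append)
next
  case False
  then show ?thesis using alt_forms_eq_0[OF assms(1)] by simp
qed

text \<open>Polarization: alternation is given as vanishing on repeated entries, so the value with
  \<open>X + Y\<close> in both slots is 0; expanding it leaves only the two mixed terms. If some
  entry is not a tangent vector at \<open>p\<close>, both sides are 0 by the extension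
  convention.\<close>

lemma alt_forms_swap_adjacent:
  assumes \<eta>: "\<eta> \<in> alt_forms A p l"
  shows "\<eta> (Us @ X # Y # Vs) = - \<eta> (Us @ Y # X # Vs)"
proof (cases "set (Us @ X # Y # Vs) \<subseteq> tangent_space A p")
  case True
  define Z where "Z = (\<lambda>f. X f + Y f)"
  have Z: "Z \<in> tangent_space A p"
    using True tangent_space_add unfolding Z_def by auto
  have alt: "\<eta> (Us @ W # W # Vs) = 0" for W
    by (rule alt_forms_alt[OF \<eta>, of "length Us" "Suc (length Us)"]) (simp_all add: nth_append)
  have fst_entry: "\<eta> (Us @ Z # W # Vs) = \<eta> (Us @ X # W # Vs) + \<eta> (Us @ Y # W # Vs)"
    if "W \<in> tangent_space A p" for W
    using alt_forms_add_entry[OF \<eta>, of Us "W # Vs" X Y] True that unfolding Z_def by simp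
  have snd_entry: "\<eta> (Us @ W # Z # Vs) = \<eta> (Us @ W # X # Vs) + \<eta> (Us @ W # Y # Vs)"
    if "W \<in> tangent_space A p" for W
    using alt_forms_add_entry[OF \<eta>, of "Us @ [W]" Vs X Y] True that unfolding Z_def by simp
  show ?thesis
    using True fst_entry[OF Z] snd_entry[of X] snd_entry[of Y] alt[of X] alt[of Y] alt[of Z]
    by simp
next
  case False
  then show ?thesis using alt_forms_eq_0[OF \<eta>] by auto
qed

lemma alt_forms_move:
  assumes "\<eta> \<in> alt_forms A p l"
  shows "\<eta> (Us @ X # Ys @ Vs) = (-1) ^ length Ys * \<eta> (Us @ Ys @ X # Vs)"
proof (induction Ys arbitrary: Us)
  case (Cons Y Ys)
  show ?case
    using alt_forms_swap_adjacent[OF assms, of Us X Y "Ys @ Vs"] Cons.IH[of "Us @ [Y]"] by simp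
qed simp

text \<open>The source of all graded signs below. In the induction the head \<open>X\<close> first
  joins the fixed prefix while \<open>Xs\<close> passes \<open>Ys\<close>; then \<open>X\<close>
  itself passes \<open>Ys\<close>, which adds \<open>length Ys\<close> transpositions.\<close>

lemma alt_forms_swap_blocks:
  assumes "\<eta> \<in> alt_forms A p l"
  shows "\<eta> (Us @ Xs @ Ys @ Vs) = (-1) ^ (length Xs * length Ys) * \<eta> (Us @ Ys @ Xs @ Vs)"
proof (induction Xs arbitrary: Us)
  case (Cons X Xs)
  show ?case
    using Cons.IH[of "Us @ [X]"] alt_forms_move[OF assms, of Us X Ys "Xs @ Vs"]
    by (simp add: power_add)
qed simp

text \<open>A decomposable is 0 by convention off the alternating forms of its degree. Hence a
  contracted form, which is a sum of partial evaluations, must be shown alternating before a second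
  multivector can be evaluated on it.\<close>

lemma alt_forms_sum:
  fixes \<eta> :: "'i \<Rightarrow> 'm tangent list \<Rightarrow> real"
  assumes "\<And>j. j \<in> J \<Longrightarrow> \<eta> j \<in> alt_forms A p l"
  shows "(\<lambda>Xs. \<Sum>j\<in>J. c j * \<eta> j Xs) \<in> alt_forms A p l"
proof (rule alt_formsI)
  fix Xs assume "(\<Sum>j\<in>J. c j * \<eta> j Xs) \<noteq> 0"
  then obtain j where j: "j \<in> J" "\<eta> j Xs \<noteq> 0"
    by (auto elim: sum.not_neutral_contains_not_neutral)
  then show "length Xs = l \<and> set Xs \<subseteq> tangent_space A p"
    using alt_forms_eq_0[OF assms[OF j(1)], of Xs] by auto
next
  fix Xs i X Y a b
  assume *: "length Xs = l" "set Xs \<subseteq> tangent_space A p" "i < l"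
    "X \<in> tangent_space A p" "Y \<in> tangent_space A p"
  have "(\<Sum>j\<in>J. c j * \<eta> j (Xs[i := \<lambda>f. a * X f + b * Y f])) =
      (\<Sum>j\<in>J. a * (c j * \<eta> j (Xs[i := X])) + b * (c j * \<eta> j (Xs[i := Y])))"
    by (intro sum.cong refl) (simp add: alt_forms_lin[OF assms *] algebra_simps)
  then show "(\<Sum>j\<in>J. c j * \<eta> j (Xs[i := \<lambda>f. a * X f + b * Y f])) =
      a * (\<Sum>j\<in>J. c j * \<eta> j (Xs[i := X])) + b * (\<Sum>j\<in>J. c j * \<eta> j (Xs[i := Y]))"
    by (simp add: sum.distrib sum_distrib_left)
next
  fix Xs :: "'m tangent list" and i j assume "i < j" "j < length Xs" "Xs ! i = Xs ! j"
  then show "(\<Sum>j\<in>J. c j * \<eta> j Xs) = 0"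
    using alt_forms_alt[OF assms] by (simp add: sum.neutral)
qed

text \<open>When the subtraction truncates, the form is 0, hence alternating of every degree.\<close>

lemma alt_forms_append_right_diff:
  assumes "\<eta> \<in> alt_forms A p l"
  shows "(\<lambda>Xs. \<eta> (Xs @ Ys)) \<in> alt_forms A p (l - length Ys)"
proof (cases "length Ys \<le> l")
  case True
  then show ?thesis using assms by (intro alt_forms_append_right) simp
next
  case False
  then have "(\<lambda>Xs. \<eta> (Xs @ Ys)) = (\<lambda>Xs. 0)"
    using alt_forms_eq_0[OF assms] by auto
  then show ?thesis by (simp add: alt_forms_zero)
qed

lemma alt_forms_append_left_diff:
  assumes "\<eta> \<in> alt_forms A p l"
  shows "(\<lambda>Ys. \<eta> (Xs @ Ys)) \<in> alt_forms A p (l - length Xs)"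
proof (cases "length Xs \<le> l")
  case True
  then show ?thesis using assms by (intro alt_forms_append_left) simp
next
  case False
  then have "(\<lambda>Ys. \<eta> (Xs @ Ys)) = (\<lambda>Xs. 0)"
    using alt_forms_eq_0[OF assms] by auto
  then show ?thesis by (simp add: alt_forms_zero)
qed

section \<open>Multivectors and contractions at a point\<close>

text \<open>Wedge and contraction act pointwise, so the chart and the smoothness of the coefficients
  are forgotten and real coefficients at the single point \<open>p\<close> remain.\<close>

definition multivector_expansion ::
    "('m, 'e::real_normed_vector) chart set \<Rightarrow> 'm \<Rightarrow> nat \<Rightarrow> 'm multivector
      \<Rightarrow> nat \<Rightarrow> (nat \<Rightarrow> real) \<Rightarrow> (nat \<Rightarrow> 'm tangent list) \<Rightarrow> bool" where
  "multivector_expansion A p q P N c X \<longleftrightarrow> (\<forall>j<N. length (X j) = q) \<and>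
     P = (\<lambda>\<eta>. \<Sum>j<N. c j * decomposable A p (X j) \<eta>)"

lemma multivector_field_expansion:
  assumes "smooth_manifold A" "multivector_field A q Q"
  obtains N c X where "multivector_expansion A p q (Q p) N c X"
proof -
  have "p \<in> (\<Union>(U, \<phi>)\<in>A. U)"
    using assms(1) unfolding smooth_manifold_def by auto
  then obtain U \<phi> where U: "(U, \<phi>) \<in> A" "p \<in> U" by auto
  from bspec[OF assms(2)[unfolded multivector_field_def] U(1)]
  obtain N c vs where *: "\<forall>j<N. smooth_on (\<phi> ` U) (c j) \<and> length (vs j) = q"
    "\<forall>p\<in>U. Q p = (\<lambda>\<eta>. \<Sum>j<(N::nat). c j (\<phi> p) *
       decomposable A p (map (coord_vec A (U, \<phi>) p) (vs j)) \<eta>)"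
    unfolding prod.case by (elim exE conjE)
  have "multivector_expansion A p q (Q p) N
      (\<lambda>j. c j (\<phi> p)) (\<lambda>j. map (coord_vec A (U, \<phi>) p) (vs j))"
    using *(1) bspec[OF *(2) U(2)] by (simp add: multivector_expansion_def)
  then show ?thesis by (rule that)
qed

text \<open>The degree \<open>l\<close> need not equal \<open>q\<close>: in a wrong degree the
  decomposables give 0 by convention, and so does \<eta> on the lists \<open>X j\<close> of length
  \<open>q\<close>. This spares case distinctions on degrees later.\<close>

lemma multivector_expansion_apply:
  assumes "multivector_expansion A p q P N c X" "\<eta> \<in> alt_forms A p l"
  shows "P \<eta> = (\<Sum>j<N. c j * \<eta> (X j))"
  using assms decomposable_append_right[OF assms(2), where Ys = "[]"]
  by (simp add: multivector_expansion_def)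

lemma contract_expansion:
  assumes "multivector_expansion A p q (Q p) N c X" "\<alpha> p \<in> alt_forms A p l"
  shows "contract Q \<alpha> p Ys = (\<Sum>j<N. c j * \<alpha> p (X j @ Ys))"
  unfolding contract_def
  by (rule multivector_expansion_apply[OF assms(1) alt_forms_append_right_diff[OF assms(2)]])

lemma contract_alt_forms:
  assumes "multivector_expansion A p q (Q p) N c X" "\<alpha> p \<in> alt_forms A p l"
  shows "contract Q \<alpha> p \<in> alt_forms A p (l - q)"
proof -
  have "contract Q \<alpha> p = (\<lambda>Ys. \<Sum>j<N. c j * \<alpha> p (X j @ Ys))"
    using contract_expansion[of A p q Q N c X \<alpha> l, OF assms] by blast
  moreover have "(\<lambda>Ys. \<alpha> p (X j @ Ys)) \<in> alt_forms A p (l - q)" if "j \<in> {..<N}" for j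
    using alt_forms_append_left_diff[OF assms(2), of "X j"] that assms(1)
    by (simp add: multivector_expansion_def)
  ultimately show ?thesis
    using alt_forms_sum[where J = "{..<N}" and \<eta> = "\<lambda>j Ys. \<alpha> p (X j @ Ys)" and c = c]
    by metis
qed

lemma contract_contract_expansion:
  assumes "multivector_expansion A p q (Q p) N c X" "multivector_expansion A p r (R p) M d Y"
    and "\<alpha> p \<in> alt_forms A p l"
  shows "contract R (contract Q \<alpha>) p Zs = (\<Sum>j<M. \<Sum>i<N. d j * c i * \<alpha> p (X i @ Y j @ Zs))"
  using contract_expansion[of A p r R M d Y "contract Q \<alpha>",
      OF assms(2) contract_alt_forms[of A p q Q N c X \<alpha> l, OF assms(1,3)]]
    contract_expansion[of A p q Q N c X \<alpha> l, OF assms(1,3)]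
  by (simp add: sum_distrib_left mult.assoc)

section \<open>Contraction: wedge products, commutation and vanishing\<close>

text \<open>The wedge puts the entries of \<open>Q\<close> in front of those of \<open>R\<close>,
  which is where contracting with \<open>Q\<close> first puts them. Both sides are therefore the
  same double sum, up to the order of summation.\<close>

lemma contract_wedge:
  assumes "smooth_manifold A" "multivector_field A q Q" "multivector_field A r R"
    and \<alpha>: "\<And>p. \<alpha> p \<in> alt_forms A p l"
  shows "contract (wedge A Q R) \<alpha> = contract R (contract Q \<alpha>)"
proof (intro ext)
  fix p Ys
  obtain N c X where Q: "multivector_expansion A p q (Q p) N c X"
    using multivector_field_expansion assms by blast
  obtain M d Y where R: "multivector_expansion A p r (R p) M d Y"
    using multivector_field_expansion assms by blast
  \<comment> \<open>Freezing the trailing arguments \<open>Ys\<close> leaves a form of degree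
    \<open>m\<close>. If \<open>Ys\<close> is longer than \<open>l\<close>, the subtraction
    truncates and \<eta> is 0.\<close>
  define \<eta> where "\<eta> = (\<lambda>Xs. \<alpha> p (Xs @ Ys))"
  define m where "m = l - length Ys"
  have \<eta>: "\<eta> \<in> alt_forms A p m"
    unfolding \<eta>_def m_def by (rule alt_forms_append_right_diff[OF \<alpha>])
  have inner: "R p (\<lambda>Zs. \<eta> (Xs @ Zs)) = (\<Sum>j<M. d j * \<eta> (Xs @ Y j))" for Xs
    by (rule multivector_expansion_apply[OF R alt_forms_append_left_diff[OF \<eta>]])
  \<comment> \<open>\<open>Q p\<close> is applied to the function that \<open>R p\<close> produces
    from \<eta>; its expansion may be used only once this function is known to be
    alternating.\<close>
  have "(\<lambda>Xs. \<eta> (Xs @ Y j)) \<in> alt_forms A p (m - r)" if "j \<in> {..<M}" for j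
    using alt_forms_append_right_diff[OF \<eta>, of "Y j"] that R
    by (simp add: multivector_expansion_def)
  then have "(\<lambda>Xs. \<Sum>j<M. d j * \<eta> (Xs @ Y j)) \<in> alt_forms A p (m - r)"
    by (rule alt_forms_sum)
  from multivector_expansion_apply[OF Q this]
  have "wedge A Q R p \<eta> = (\<Sum>i<N. c i * (\<Sum>j<M. d j * \<eta> (X i @ Y j)))"
    using \<eta> by (auto simp: wedge_def inner)
  also have "\<dots> = (\<Sum>j<M. \<Sum>i<N. d j * c i * \<eta> (X i @ Y j))"
    by (subst sum.swap) (simp add: sum_distrib_left mult_ac)
  finally show "contract (wedge A Q R) \<alpha> p Ys = contract R (contract Q \<alpha>) p Ys"
    using contract_contract_expansion[of A p q Q N c X r R M d Y \<alpha> l Ys, OF Q R \<alpha>]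
    by (simp add: contract_def \<eta>_def)
qed

text \<open>In each term of the double sum, the block \<open>X i\<close> of length \<open>q\<close>
  is exchanged with the block \<open>Y j\<close> of length \<open>r\<close>, so every term acquires
  the same sign.\<close>

lemma contract_commute:
  assumes "smooth_manifold A" "multivector_field A q Q" "multivector_field A r R"
    and \<alpha>: "\<And>p. \<alpha> p \<in> alt_forms A p l"
  shows "contract R (contract Q \<alpha>) = (\<lambda>p Ys. (-1) ^ (q * r) * contract Q (contract R \<alpha>) p Ys)"
proof (intro ext)
  fix p Ys
  obtain N c X where Q: "multivector_expansion A p q (Q p) N c X"
    using multivector_field_expansion assms by blast
  obtain M d Y where R: "multivector_expansion A p r (R p) M d Y"
    using multivector_field_expansion assms by blast
  have "\<alpha> p (X i @ Y j @ Ys) = (-1) ^ (q * r) * \<alpha> p (Y j @ X i @ Ys)" if "i < N" "j < M" for i j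
    using alt_forms_swap_blocks[OF \<alpha>, where Us = "[]" and Xs = "X i" and Ys = "Y j" and Vs = Ys]
      that Q R
    by (simp add: multivector_expansion_def)
  then have "contract R (contract Q \<alpha>) p Ys =
      (\<Sum>j<M. \<Sum>i<N. (-1) ^ (q * r) * (c i * d j * \<alpha> p (Y j @ X i @ Ys)))"
    unfolding contract_contract_expansion[of A p q Q N c X r R M d Y \<alpha> l, OF Q R \<alpha>]
    by (intro sum.cong refl) simp
  also have "\<dots> = (-1) ^ (q * r) * contract Q (contract R \<alpha>) p Ys"
    unfolding contract_contract_expansion[of A p r R M d Y q Q N c X \<alpha> l, OF R Q \<alpha>]
    by (subst sum.swap) (simp add: sum_distrib_left)
  finally show "contract R (contract Q \<alpha>) p Ys =
      (-1) ^ (q * r) * contract Q (contract R \<alpha>) p Ys" .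
qed

lemma contract_eq_zero_form:
  assumes "smooth_manifold A" "multivector_field A q Q"
    and \<alpha>: "\<And>p. \<alpha> p \<in> alt_forms A p l" and "l < q"
  shows "contract Q \<alpha> = zero_form"
proof (intro ext)
  fix p Ys
  obtain N c X where Q: "multivector_expansion A p q (Q p) N c X"
    using multivector_field_expansion assms by blast
  \<comment> \<open>The list has at least \<open>q\<close> entries, more than the degree
    \<open>l\<close>.\<close>
  have "\<alpha> p (X j @ Ys) = 0" if "j < N" for j
    using that Q \<open>l < q\<close>
    by (intro alt_forms_eq_0[OF \<alpha>]) (simp add: multivector_expansion_def)
  then show "contract Q \<alpha> p Ys = zero_form p Ys"
    using contract_expansion[of A p q Q N c X \<alpha> l, OF Q \<alpha>] by (simp add: zero_form_def)
qed

section \<open>Lie derivative and bracket\<close>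

lemma ext_deriv_zero_form: "ext_deriv A zero_form = zero_form"
  by (intro ext) (simp add: ext_deriv_def zero_form_def Let_def)

lemma lie_deriv_eq_contract:
  assumes "smooth_manifold A" "multivector_field A q Q"
    and "\<And>p. \<alpha> p \<in> alt_forms A p l" and "l < q"
  shows "lie_deriv A q Q \<alpha> = contract Q (ext_deriv A \<alpha>)"
proof -
  have "contract Q \<alpha> = zero_form"
    by (rule contract_eq_zero_form[OF assms])
  then show ?thesis
    unfolding lie_deriv_def by (simp add: ext_deriv_zero_form) (simp add: zero_form_def)
qed

lemma scaled_eq_zero_form_iff:
  assumes "c \<noteq> 0"
  shows "(\<lambda>p Ys. c * \<alpha> p Ys) = zero_form \<longleftrightarrow> \<alpha> = zero_form"
  using assms by (simp add: zero_form_def fun_eq_iff)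

text \<open>Needed because \<open>bracket\<close> selects its multivector fields by
  \<open>SOME\<close>, whereas the Lie derivatives use the given ones.\<close>

lemma contract_wedge_associated:
  assumes "smooth_manifold A" and \<omega>: "\<And>p. \<omega> p \<in> alt_forms A p l"
    and P: "associated A \<omega> q1 \<alpha>1 P1" "associated A \<omega> q2 \<alpha>2 P2"
    and Q: "associated A \<omega> q1 \<alpha>1 Q1" "associated A \<omega> q2 \<alpha>2 Q2"
  shows "contract (wedge A P1 P2) \<omega> = contract (wedge A Q1 Q2) \<omega>"
proof -
  have mv: "multivector_field A q1 P1" "multivector_field A q2 P2"
    "multivector_field A q1 Q1" "multivector_field A q2 Q2"
    and eq: "contract P1 \<omega> = contract Q1 \<omega>" "contract P2 \<omega> = contract Q2 \<omega>"
    using P Q by (simp_all add: associated_def)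
  \<comment> \<open>Being applied to \<omega> directly, \<open>P1\<close> is replaced by
    \<open>Q1\<close> at once. To replace \<open>P2\<close>, it is commuted inwards to \<omega>,
    exchanged for \<open>Q2\<close> and commuted back; the two signs agree because the degrees
    do.\<close>
  have "contract P2 (contract P1 \<omega>) = contract Q2 (contract Q1 \<omega>)"
    using contract_commute[of A q1 Q1 q2 P2 \<omega> l] contract_commute[of A q1 Q1 q2 Q2 \<omega> l]
      assms(1) \<omega> mv by (simp add: eq)
  then show ?thesis
    using contract_wedge[of A q1 P1 q2 P2 \<omega> l] contract_wedge[of A q1 Q1 q2 Q2 \<omega> l]
      assms(1) \<omega> mv by simp
qed

theorem proposition2p2:
  fixes A :: "('m::{t2_space,second_countable_topology}, 'e::real_normed_vector) chart set"
    and k q1 q2 :: nat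
    and \<omega> \<alpha>1 \<alpha>2 :: "'m form"
    and Q1 Q2 :: "'m \<Rightarrow> 'm multivector"
  assumes "multisymplectic A k \<omega>"
    and "hamiltonian_form A k \<omega> q1 \<alpha>1" and "associated A \<omega> q1 \<alpha>1 Q1"
    and "hamiltonian_form A k \<omega> q2 \<alpha>2" and "associated A \<omega> q2 \<alpha>2 Q2"
    and "q1 + q2 = k + 1"
  shows "(bracket A k \<omega> q1 q2 \<alpha>1 \<alpha>2 = zero_form \<longleftrightarrow> lie_deriv A q2 Q2 \<alpha>1 = zero_form) \<and>
         (bracket A k \<omega> q1 q2 \<alpha>1 \<alpha>2 = zero_form \<longleftrightarrow> lie_deriv A q1 Q1 \<alpha>2 = zero_form)"
proof -
  have M: "smooth_manifold A" and \<omega>: "\<omega> p \<in> alt_forms A p (k + 1)" for p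
    using assms(1) by (simp_all add: multisymplectic_def smooth_form_def)
  have Q: "multivector_field A q1 Q1" "multivector_field A q2 Q2"
    and d: "ext_deriv A \<alpha>1 = contract Q1 \<omega>" "ext_deriv A \<alpha>2 = contract Q2 \<omega>"
    using assms(3,5) by (simp_all add: associated_def)
  have \<alpha>: "\<alpha>1 p \<in> alt_forms A p (k - q1)" "\<alpha>2 p \<in> alt_forms A p (k - q2)" for p
    using assms(2,4) by (simp_all add: hamiltonian_form_def smooth_form_def)
  have deg: "k - q1 < q2" "k - q2 < q1"
    using assms(2,4,6) by (auto simp: hamiltonian_form_def)
  have L2: "lie_deriv A q2 Q2 \<alpha>1 = contract Q2 (contract Q1 \<omega>)"
    using lie_deriv_eq_contract[OF M Q(2) \<alpha>(1) deg(1)] d by simp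
  have L1: "lie_deriv A q1 Q1 \<alpha>2 = contract Q1 (contract Q2 \<omega>)"
    using lie_deriv_eq_contract[OF M Q(1) \<alpha>(2) deg(2)] d by simp
  have "bracket A k \<omega> q1 q2 \<alpha>1 \<alpha>2 =
      (\<lambda>p Ys. (-1) ^ (q1 + q2 + 1) * contract Q2 (contract Q1 \<omega>) p Ys)"
    \<comment> \<open>The given fields witness that the \<open>SOME\<close> choices are associated
      too, and \<open>q1 + q2 = k + 1\<close> rules out the branch of \<open>bracket\<close> that is
      0 by definition.\<close>
    using contract_wedge_associated[OF M \<omega> someI[of "associated A \<omega> q1 \<alpha>1", OF assms(3)]
        someI[of "associated A \<omega> q2 \<alpha>2", OF assms(5)] assms(3,5)]
      contract_wedge[OF M Q \<omega>] assms(6)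
    by (simp add: bracket_def Let_def)
  then have B: "bracket A k \<omega> q1 q2 \<alpha>1 \<alpha>2 = zero_form \<longleftrightarrow> contract Q2 (contract Q1 \<omega>) = zero_form"
    using scaled_eq_zero_form_iff[of "(-1) ^ (q1 + q2 + 1)"] by simp
  also have "\<dots> \<longleftrightarrow> contract Q1 (contract Q2 \<omega>) = zero_form"
    unfolding contract_commute[OF M Q \<omega>] by (rule scaled_eq_zero_form_iff) simp
  finally show ?thesis using B L1 L2 by simp
qed

end
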